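(* Let $V$ be a finite totally ordered set of odd size such that $|V|\geq 7$. Let $Q$ be a quasi-pairing of $V$ and let $T:=\mathrm{Inv}(\underline{V},Q)$. The following two assertions are equivalent. (1) The quasi-pairing $Q$ is irreducible. (2) At least one of the tournaments $T$, $T-v_Q^-$, or $T-v_Q^+$ is indecomposable.
   Context: A tournament $T=(V(T),A(T))$ consists of a finite vertex set $V(T)$ and a set $A(T)$ of ordered pairs of distinct vertices (arcs) such that for all $x\neq y$ in $V(T)$, $(x,y)\in A(T)$ if and only if $(y,x)\notin A(T)$. For a vertex $v$, $T-v$ denotes the subtournament of $T$ induced by $V(T)\setminus\{v\}$. For a totally ordered set $V$, $\underline{V}$ denotes the transitive tournament $(V,\{(x,y)\in V\times V: x<y\})$. For $Q\subseteq \binom{V}{2}$ (a set of unordered pairs of distinct elements), $\mathrm{Inv}(\underline{V},Q)$ is the tournament on $V$ obtained from $\underline{V}$ by reversing every arc $(x,y)$ such that $\{x,y\}\in Q$; $\cup Q$ denotes the union of the pairs in $Q$. A module of a tournament $T$ is a subset $M\subseteq V(T)$ such that for every $v\in V(T)\setminus M$, either $\{v\}\times M\subseteq A(T)$ or $M\times\{v\}\subseteq A(T)$. The trivial modules are $\emptyset$, $V(T)$ and the singletons. $T$ is indecomposable if all its modules are trivial. A quasi-pairing of a set $V$ of size $2m+1$ with $m\geq 1$ is a subset $Q\subseteq\binom{V}{2}$ with $|Q|=m+1$ and $\cup Q=V$. In a quasi-pairing $Q$ exactly one element, denoted $\hat v_Q$, belongs to two pairs of $Q$ and every other element of $V$ belongs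 to exactly one pair; $v_Q^-<v_Q^+$ denote the two elements such that $\{\hat v_Q,v_Q^-\},\{\hat v_Q,v_Q^+\}\in Q$, and $B_Q:=\{\hat v_Q,v_Q^-,v_Q^+\}$. Let $Q_{\mathrm{part}}:=(Q\setminus\{\{\hat v_Q,v_Q^-\},\{\hat v_Q,v_Q^+\}\})\cup\{B_Q\}$, which is a partition of $V$. An interval of a totally ordered set $V$ is a subset $I\subseteq V$ such that every element of $V\setminus I$ is greater than all the elements of $I$ or smaller than all of them; it is nontrivial if it is neither $\emptyset$, nor a singleton, nor $V$. A partition of $V$ is irreducible if no nontrivial interval of $V$ is a union of blocks. The quasi-pairing $Q$ is irreducible if the partition $Q_{\mathrm{part}}$ is irreducible. *)

theory Defs
  imports
    "Graph_Theory.Digraph"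
    "Graph_Theory.Pair_Digraph"
    "HOL-Library.Disjoint_Sets"
begin

locale tournament = digraph G for G :: "('a, 'b) pre_digraph" (structure) +
  assumes tournament_arcs:
    "\<lbrakk>x \<in> verts G; y \<in> verts G; x \<noteq> y\<rbrakk> \<Longrightarrow> (x, y) \<in> arcs_ends G \<longleftrightarrow> (y, x) \<notin> arcs_ends G"

definition module :: "('a, 'b) pre_digraph \<Rightarrow> 'a set \<Rightarrow> bool" where
  "module T M \<longleftrightarrow> M \<subseteq> verts T \<and>
     (\<forall>v \<in> verts T - M. {v} \<times> M \<subseteq> arcs_ends T \<or> M \<times> {v} \<subseteq> arcs_ends T)"

definition trivial_module :: "('a, 'b) pre_digraph \<Rightarrow> 'a set \<Rightarrow> bool" where
  "trivial_module T M \<longleftrightarrow> M = {} \<or> M = verts T \<or> (\<exists>v \<in> verts T. M = {v})"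

definition indecomposable :: "('a, 'b) pre_digraph \<Rightarrow> bool" where
  "indecomposable T \<longleftrightarrow> (\<forall>M. module T M \<longrightarrow> trivial_module T M)"

definition transitive_tournament :: "'a::linorder set \<Rightarrow> 'a pair_pre_digraph" where
  "transitive_tournament V = \<lparr>pverts = V, parcs = {(x, y) \<in> V \<times> V. x < y}\<rparr>"

definition Inv :: "'a pair_pre_digraph \<Rightarrow> 'a set set \<Rightarrow> 'a pair_pre_digraph" where
  "Inv T Q = \<lparr>pverts = pverts T,
     parcs = {(x, y) \<in> parcs T. {x, y} \<notin> Q} \<union> {(y, x) | x y. (x, y) \<in> parcs T \<and> {x, y} \<in> Q}\<rparr>"

lemma tournament_Inv:
  fixes V :: "'a::linorder set"
  assumes "finite V"
  shows "tournament (with_proj (Inv (transitive_tournament V) Q))"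
proof -
  let ?T = "Inv (transitive_tournament V) Q"
  have "parcs ?T \<subseteq> V \<times> V"
    by (auto simp: Inv_def transitive_tournament_def)
  then have "finite (parcs ?T)"
    using assms finite_subset by blast
  moreover have A: "(x, y) \<in> parcs ?T \<longleftrightarrow>
      x \<in> V \<and> y \<in> V \<and> (x < y \<and> {x, y} \<notin> Q \<or> y < x \<and> {y, x} \<in> Q)" for x y
    by (auto simp: Inv_def transitive_tournament_def)
  moreover have V: "pverts ?T = V"
    by (simp add: Inv_def transitive_tournament_def)
  ultimately interpret D: fin_digraph "with_proj ?T"
    using assms by unfold_locales auto
  show ?thesis
  proof unfold_locales
    fix e assume "e \<in> arcs ?T"
    then show "tail ?T e \<noteq> head ?T e"
      using A[of "fst e" "snd e"] by auto
  next
    fix e f assume "arc_to_ends ?T e = arc_to_ends ?T f"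
    then show "e = f"
      by (simp add: arc_to_ends_def prod_eq_iff)
  next
    fix x y assume "x \<in> verts ?T" "y \<in> verts ?T" "x \<noteq> y"
    then have "x \<in> V" "y \<in> V" "x < y \<or> y < x"
      by (auto simp: V)
    then show "(x, y) \<in> arcs_ends ?T \<longleftrightarrow> (y, x) \<notin> arcs_ends ?T"
      by (auto simp: A)
  qed
qed

lemma (in tournament) tournament_del_vert: "tournament (del_vert v)"
proof -
  interpret D: fin_digraph "del_vert v"
    by (rule fin_digraph_del_vert)
  have E: "(x, y) \<in> arcs_ends (del_vert v) \<longleftrightarrow> (x, y) \<in> arcs_ends G \<and> x \<noteq> v \<and> y \<noteq> v" for x y
    by (auto simp: arcs_ends_conv del_vert_simps image_iff)
  show ?thesis
  proof unfold_locales
    fix e assume "e \<in> arcs (del_vert v)"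
    then show "tail (del_vert v) e \<noteq> head (del_vert v) e"
      using no_loops by (simp add: del_vert_simps)
  next
    fix e f assume "e \<in> arcs (del_vert v)" "f \<in> arcs (del_vert v)"
      "arc_to_ends (del_vert v) e = arc_to_ends (del_vert v) f"
    then show "e = f"
      using no_multi_arcs by (simp add: del_vert_simps ends_del_vert)
  next
    fix x y assume "x \<in> verts (del_vert v)" "y \<in> verts (del_vert v)" "x \<noteq> y"
    then show "(x, y) \<in> arcs_ends (del_vert v) \<longleftrightarrow> (y, x) \<notin> arcs_ends (del_vert v)"
      using tournament_arcs[of x y] E by (simp add: del_vert_simps)
  qed
qed


definition quasi_pairing :: "'a set \<Rightarrow> 'a set set \<Rightarrow> bool" where
  "quasi_pairing V Q \<longleftrightarrow> (\<exists>m \<ge> 1. card V = 2 * m + 1 \<and>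
     Q \<subseteq> {e. e \<subseteq> V \<and> card e = 2} \<and> card Q = m + 1 \<and> \<Union>Q = V)"

definition v_hat :: "'a set set \<Rightarrow> 'a" where
  "v_hat Q = (THE v. card {e \<in> Q. v \<in> e} = 2)"

definition v_minus :: "'a::linorder set set \<Rightarrow> 'a" where
  "v_minus Q = Min {w. {v_hat Q, w} \<in> Q}"

definition v_plus :: "'a::linorder set set \<Rightarrow> 'a" where
  "v_plus Q = Max {w. {v_hat Q, w} \<in> Q}"

definition B_block :: "'a::linorder set set \<Rightarrow> 'a set" where
  "B_block Q = {v_hat Q, v_minus Q, v_plus Q}"

definition Q_part :: "'a::linorder set set \<Rightarrow> 'a set set" where
  "Q_part Q = (Q - {{v_hat Q, v_minus Q}, {v_hat Q, v_plus Q}}) \<union> {B_block Q}"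

definition is_interval_of :: "'a::linorder set \<Rightarrow> 'a set \<Rightarrow> bool" where
  "is_interval_of V I \<longleftrightarrow> I \<subseteq> V \<and> (\<forall>x \<in> V - I. (\<forall>i \<in> I. i < x) \<or> (\<forall>i \<in> I. x < i))"

definition nontrivial_interval_of :: "'a::linorder set \<Rightarrow> 'a set \<Rightarrow> bool" where
  "nontrivial_interval_of V I \<longleftrightarrow> is_interval_of V I \<and> I \<noteq> {} \<and> \<not> is_singleton I \<and> I \<noteq> V"

definition irreducible_partition :: "'a::linorder set \<Rightarrow> 'a set set \<Rightarrow> bool" where
  "irreducible_partition V P \<longleftrightarrow> partition_on V P \<and>
     \<not> (\<exists>I. nontrivial_interval_of V I \<and> (\<exists>\<B> \<subseteq> P. I = \<Union>\<B>))"

definition irreducible_quasi_pairing :: "'a::linorder set \<Rightarrow> 'a set set \<Rightarrow> bool" where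
  "irreducible_quasi_pairing V Q \<longleftrightarrow> quasi_pairing V Q \<and> irreducible_partition V (Q_part Q)"

text \<open>
  The next facts show that the elements denoted by \<^const>\<open>v_hat\<close>, \<^const>\<open>v_minus\<close> and
  \<^const>\<open>v_plus\<close> exist and are the intended ones.
\<close>

lemma quasi_pairing_degrees:
  assumes "quasi_pairing V Q"
  shows "\<exists>v \<in> V. card {e \<in> Q. v \<in> e} = 2 \<and> (\<forall>w \<in> V - {v}. card {e \<in> Q. w \<in> e} = 1)"
proof -
  let ?d = "\<lambda>v. card {e \<in> Q. v \<in> e}"
  from assms obtain m where m: "m \<ge> 1" "card V = 2 * m + 1"
    and Q: "Q \<subseteq> {e. e \<subseteq> V \<and> card e = 2}" "card Q = m + 1" "\<Union>Q = V"
    unfolding quasi_pairing_def by blast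
  have fin: "finite V" "finite Q"
    using m Q(2) by (auto intro: card_ge_0_finite)
  have "(\<Sum>v\<in>V. ?d v) = (\<Sum>e\<in>Q. card {v \<in> V. v \<in> e})"
    using sum_multicount_gen[of V Q "\<lambda>v e. v \<in> e" "\<lambda>e. card {v \<in> V. v \<in> e}"] fin by simp
  also have "\<dots> = (\<Sum>e\<in>Q. 2)"
  proof (rule sum.cong[OF refl])
    fix e assume "e \<in> Q"
    with Q have "{v \<in> V. v \<in> e} = e" "card e = 2" by auto
    then show "card {v \<in> V. v \<in> e} = 2" by simp
  qed
  finally have S: "(\<Sum>v\<in>V. ?d v) = 2 * m + 2"
    using Q(2) by simp
  have pos: "?d v \<ge> 1" if "v \<in> V" for v
    using that Q(3) fin(2) by (force simp: Suc_le_eq card_gt_0_iff)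
  have "(\<Sum>v\<in>V. ?d v) = (\<Sum>v\<in>V. (?d v - 1) + 1)"
    using pos by (intro sum.cong refl) (simp del: One_nat_def)
  also have "\<dots> = (\<Sum>v\<in>V. ?d v - 1) + card V"
    by (simp only: sum.distrib) simp
  finally have "(\<Sum>v\<in>V. ?d v - 1) = 1"
    using S m by simp
  then have "\<exists>v\<in>V. ?d v - 1 = 1 \<and> (\<forall>w\<in>V. v \<noteq> w \<longrightarrow> ?d w - 1 = 0)"
    by (subst (asm) sum_eq_1_iff[OF fin(1)])
  then obtain v where v: "v \<in> V" "?d v - 1 = 1" "\<forall>w\<in>V. v \<noteq> w \<longrightarrow> ?d w - 1 = 0"
    by blast
  have "?d v = 2" using v(2) by simp
  moreover have "?d w = 1" if "w \<in> V - {v}" for w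
    using that v(3) pos[of w] by force
  ultimately show ?thesis using v(1) by blast
qed

lemma v_hat_degree:
  assumes "quasi_pairing V Q"
  shows "v_hat Q \<in> V" "card {e \<in> Q. v_hat Q \<in> e} = 2"
    "w \<in> V - {v_hat Q} \<Longrightarrow> card {e \<in> Q. w \<in> e} = 1"
proof -
  obtain v where v: "v \<in> V" "card {e \<in> Q. v \<in> e} = 2"
    "\<forall>w \<in> V - {v}. card {e \<in> Q. w \<in> e} = 1"
    using quasi_pairing_degrees[OF assms] by blast
  have "x = v" if x: "card {e \<in> Q. x \<in> e} = 2" for x
  proof (rule ccontr)
    assume "x \<noteq> v"
    have "{e \<in> Q. x \<in> e} \<noteq> {}" using x by (metis card.empty zero_neq_numeral)
    then have "x \<in> V" using assms unfolding quasi_pairing_def by blast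
    with v(3) x \<open>x \<noteq> v\<close> show False by force
  qed
  then have "v_hat Q = v" unfolding v_hat_def using v(2) by (intro the_equality)
  with v show "v_hat Q \<in> V" "card {e \<in> Q. v_hat Q \<in> e} = 2"
    "w \<in> V - {v_hat Q} \<Longrightarrow> card {e \<in> Q. w \<in> e} = 1" by auto
qed

lemma v_minus_v_plus:
  assumes "quasi_pairing V Q"
  shows "{w. {v_hat Q, w} \<in> Q} = {v_minus Q, v_plus Q}" "v_minus Q < v_plus Q"
    "v_hat Q \<noteq> v_minus Q" "v_hat Q \<noteq> v_plus Q"
proof -
  let ?N = "{w. {v_hat Q, w} \<in> Q}"
  have two: "card e = 2" if "e \<in> Q" for e
    using assms that unfolding quasi_pairing_def by blast
  have nh: "v_hat Q \<notin> ?N"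
  proof
    assume "v_hat Q \<in> ?N"
    then have "card {v_hat Q, v_hat Q} = 2" using two by blast
    then show False by simp
  qed
  have "inj_on (\<lambda>w. {v_hat Q, w}) ?N"
    by (rule inj_onI) (metis doubleton_eq_iff)
  moreover have "(\<lambda>w. {v_hat Q, w}) ` ?N = {e \<in> Q. v_hat Q \<in> e}"
  proof (intro equalityI subsetI)
    fix e assume e: "e \<in> {e \<in> Q. v_hat Q \<in> e}"
    then have "card e = 2" using two by blast
    then obtain x y where "e = {x, y}" by (meson card_2_iff)
    moreover from e this have "v_hat Q = x \<or> v_hat Q = y" by blast
    ultimately obtain w where w: "e = {v_hat Q, w}" by (metis insert_commute)
    with e have "w \<in> ?N" by simp
    with w show "e \<in> (\<lambda>w. {v_hat Q, w}) ` ?N" by (rule image_eqI)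
  next
    fix e assume "e \<in> (\<lambda>w. {v_hat Q, w}) ` ?N"
    then obtain w where "e = {v_hat Q, w}" "w \<in> ?N" by (rule imageE)
    then show "e \<in> {e \<in> Q. v_hat Q \<in> e}" by simp
  qed
  ultimately have "card ?N = card {e \<in> Q. v_hat Q \<in> e}"
    by (metis (no_types, lifting) card_image)
  then have "card ?N = 2" unfolding v_hat_degree(2)[OF assms] .
  then obtain x y where xy: "?N = {x, y}" "x \<noteq> y" by (meson card_2_iff)
  have mm: "v_minus Q = min x y" "v_plus Q = max x y"
    unfolding v_minus_def v_plus_def xy(1) by simp_all
  show N: "?N = {v_minus Q, v_plus Q}"
    unfolding mm xy(1) by (auto simp: min_def max_def)
  show "v_minus Q < v_plus Q"
    unfolding mm using xy(2) by (auto simp: min_def max_def)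
  show "v_hat Q \<noteq> v_minus Q" "v_hat Q \<noteq> v_plus Q"
    using nh unfolding N by blast+
qed

lemma partition_on_Q_part:
  assumes "quasi_pairing V Q"
  shows "partition_on V (Q_part Q)"
proof -
  let ?h = "v_hat Q" and ?a = "v_minus Q" and ?b = "v_plus Q"
  note N = v_minus_v_plus[OF assms]
  have Q: "Q \<subseteq> {e. e \<subseteq> V \<and> card e = 2}" "\<Union>Q = V"
    using assms unfolding quasi_pairing_def by blast+
  have in_Q: "{?h, ?a} \<in> Q" "{?h, ?b} \<in> Q" using N(1) by blast+
  have uniq: "e = f" if "e \<in> Q" "f \<in> Q" "w \<in> e" "w \<in> f" "w \<noteq> ?h" for e f w
  proof -
    have "w \<in> V" using that Q(2) by blast
    with \<open>w \<noteq> ?h\<close> have "card {e \<in> Q. w \<in> e} = 1"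
      using v_hat_degree(3)[OF assms, of w] by blast
    then obtain g where "{e \<in> Q. w \<in> e} = {g}"
      by (rule card_1_singletonE)
    moreover have "e \<in> {e \<in> Q. w \<in> e}" "f \<in> {e \<in> Q. w \<in> e}" using that by auto
    ultimately show ?thesis by simp
  qed
  have hat: "e = {?h, ?a} \<or> e = {?h, ?b}" if "e \<in> Q" "?h \<in> e" for e
  proof -
    have "card e = 2" using that Q(1) by blast
    then obtain x y where "e = {x, y}" by (meson card_2_iff)
    with that have "\<exists>w. e = {?h, w}" by auto
    then obtain w where w: "e = {?h, w}" by blast
    with that(1) have "w \<in> {w. {?h, w} \<in> Q}" by simp
    then have "w \<in> {?a, ?b}" unfolding N(1) .
    with w show ?thesis by blast
  qed
  have "\<Union>(Q_part Q) = V"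
  proof -
    have "Q = (Q - {{?h, ?a}, {?h, ?b}}) \<union> {{?h, ?a}, {?h, ?b}}"
      using in_Q by blast
    then have "\<Union>Q = \<Union>(Q - {{?h, ?a}, {?h, ?b}}) \<union> ({?h, ?a} \<union> {?h, ?b})"
      by (metis Union_Un_distrib Union_insert Union_empty Un_empty_right)
    also have "{?h, ?a} \<union> {?h, ?b} = B_block Q"
      by (auto simp: B_block_def)
    finally show ?thesis
      unfolding Q_part_def Q(2) by (simp add: Un_commute)
  qed
  moreover have "{} \<notin> Q_part Q"
  proof
    assume "{} \<in> Q_part Q"
    then have "{} \<in> Q" by (simp add: Q_part_def B_block_def)
    then have "card ({} :: 'a set) = 2" using Q(1) by blast
    then show False by simp
  qed
  moreover have "disjoint (Q_part Q)"
  proof -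
    have B: "e \<inter> B_block Q = {}" if "e \<in> Q - {{?h, ?a}, {?h, ?b}}" for e
    proof -
      have "?h \<notin> e" using that hat[of e] by blast
      moreover have "?a \<notin> e" using that uniq[of e "{?h, ?a}" ?a] in_Q N(3) by auto
      moreover have "?b \<notin> e" using that uniq[of e "{?h, ?b}" ?b] in_Q N(4) by auto
      ultimately show ?thesis by (simp add: B_block_def)
    qed
    have "e \<inter> f = {}" if "e \<in> Q - {{?h, ?a}, {?h, ?b}}" "f \<in> Q" "e \<noteq> f" for e f
    proof (rule ccontr)
      assume "e \<inter> f \<noteq> {}"
      then obtain w where "w \<in> e" "w \<in> f" by blast
      moreover have "w \<noteq> ?h" using hat[of e] \<open>w \<in> e\<close> that(1) by auto
      ultimately show False using uniq[of e f w] that by blast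
    qed
    moreover have "B_block Q \<inter> e = {}" if "e \<in> Q - {{?h, ?a}, {?h, ?b}}" for e
      using B[OF that] by (simp add: Int_commute)
    ultimately show ?thesis
      using B unfolding Q_part_def by (intro disjointI) (elim UnE; simp)
  qed
  ultimately show ?thesis
    by (auto simp: partition_on_def)
qed

end

theory Submission
  imports Defs
begin

text \<open>
  A set \<open>M\<close> is a module of \<open>Inv V Q\<close> iff, for every \<open>z \<in> V - M\<close> and \<open>x, y \<in> M\<close>, the vertex \<open>z\<close> lies
  between \<open>x\<close> and \<open>y\<close> exactly when it is matched by \<open>Q\<close> to precisely one of them. In these terms the
  order enters only through betweenness, so no case distinction up to reversal is needed.
  An interval closed under \<open>Q\<close> is a module, and it survives the deletion of a leaf of \<open>B\<^sub>Q\<close>.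
  Conversely, let there be no proper closed interval. If no edge of \<open>Q\<close> joins consecutive elements and
  the two leaves are not consecutive, then a module with at least three elements is a closed
  interval, and the interval spanned by a two-element module is closed unless it consists of
  \<open>p, z, h, c\<close> in this order, where \<open>p\<close> is a leaf of the hub \<open>h\<close> and \<open>z\<close> is matched to \<open>c\<close>.
  If \<open>V\<close> without a leaf \<open>p\<close> has a proper closed interval, then \<open>p\<close> is not consecutive to
  the other elements of \<open>B\<^sub>Q\<close> and this configuration does not occur for \<open>p\<close>.
\<close>

section \<open>Betweenness and intervals closed under a set of pairs\<close>

definition btw :: "'a::linorder \<Rightarrow> 'a \<Rightarrow> 'a \<Rightarrow> bool" where
  "btw x z y \<longleftrightarrow> x < z \<and> z < y \<or> y < z \<and> z < x"

definition edge :: "'a set set \<Rightarrow> 'a \<Rightarrow> 'a \<Rightarrow> bool" where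
  "edge Q x y \<longleftrightarrow> {x, y} \<in> Q"

definition consecutive :: "'a::linorder set \<Rightarrow> 'a \<Rightarrow> 'a \<Rightarrow> bool" where
  "consecutive V x y \<longleftrightarrow> (\<forall>z\<in>V. \<not> btw x z y)"

text \<open>For a quasi-pairing these are the nontrivial intervals that are unions of blocks of
  \<open>Q_part Q\<close>; singletons are excluded by the existence of neighbours. The bound
  \<open>y\<in>V\<close> matters once a leaf is deleted from \<open>V\<close> while \<open>Q\<close>
  keeps its edge.\<close>

definition closed_interval :: "'a::linorder set \<Rightarrow> 'a set set \<Rightarrow> 'a set \<Rightarrow> bool" where
  "closed_interval V Q I \<longleftrightarrow> is_interval_of V I \<and> I \<noteq> {} \<and> I \<noteq> V \<and>
     (\<forall>x\<in>I. \<forall>y\<in>V. edge Q x y \<longrightarrow> y \<in> I)"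

lemma edge_commute: "edge Q x y \<longleftrightarrow> edge Q y x"
  by (simp add: edge_def insert_commute)

lemma btw_commute: "btw x z y \<longleftrightarrow> btw y z x"
  by (auto simp: btw_def)

lemma consecutive_commute: "consecutive V x y \<longleftrightarrow> consecutive V y x"
  by (auto simp: consecutive_def btw_commute)

lemma btw_split: "btw x p y \<Longrightarrow> btw p z w \<Longrightarrow> btw x z w \<or> btw y z w"
  by (auto simp: btw_def)

lemma is_interval_of_iff_btw:
  "is_interval_of V I \<longleftrightarrow> I \<subseteq> V \<and> (\<forall>x\<in>I. \<forall>y\<in>I. \<forall>z\<in>V. btw x z y \<longrightarrow> z \<in> I)"
proof
  assume "is_interval_of V I"
  then show "I \<subseteq> V \<and> (\<forall>x\<in>I. \<forall>y\<in>I. \<forall>z\<in>V. btw x z y \<longrightarrow> z \<in> I)"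
    unfolding is_interval_of_def btw_def by (meson DiffI less_asym)
next
  assume "I \<subseteq> V \<and> (\<forall>x\<in>I. \<forall>y\<in>I. \<forall>z\<in>V. btw x z y \<longrightarrow> z \<in> I)"
  then show "is_interval_of V I"
    unfolding is_interval_of_def btw_def by (metis DiffD1 DiffD2 linorder_neqE)
qed

lemma closed_intervalD:
  assumes "closed_interval V Q I"
  shows "I \<subseteq> V" "I \<noteq> {}" "I \<noteq> V"
    "\<And>x y z. x \<in> I \<Longrightarrow> y \<in> I \<Longrightarrow> z \<in> V \<Longrightarrow> btw x z y \<Longrightarrow> z \<in> I"
    "\<And>x y. x \<in> I \<Longrightarrow> y \<in> V \<Longrightarrow> edge Q x y \<Longrightarrow> y \<in> I"
  using assms unfolding closed_interval_def is_interval_of_iff_btw by blast+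

lemma closed_intervalI:
  assumes "I \<subseteq> V" "I \<noteq> {}" "I \<noteq> V"
    "\<And>x y z. x \<in> I \<Longrightarrow> y \<in> I \<Longrightarrow> z \<in> V \<Longrightarrow> btw x z y \<Longrightarrow> z \<in> I"
    "\<And>x y. x \<in> I \<Longrightarrow> y \<in> V \<Longrightarrow> edge Q x y \<Longrightarrow> y \<in> I"
  shows "closed_interval V Q I"
  using assms unfolding closed_interval_def is_interval_of_iff_btw by blast

lemma exists_consecutive:
  fixes p :: "'a::linorder"
  assumes "finite V" "z \<in> V" "z \<noteq> p"
  obtains w where "w \<in> V" "w \<noteq> p" "consecutive V p w" "w = z \<or> btw p w z"
proof (cases "p < z")
  case True
  let ?S = "{w \<in> V. p < w}"
  have S: "finite ?S" "z \<in> ?S" using assms True by auto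
  have "Min ?S \<in> ?S" using S by (intro Min_in) auto
  moreover have le: "Min ?S \<le> w" if "w \<in> ?S" for w using S(1) that by (rule Min_le)
  moreover note le[OF S(2)]
  ultimately show thesis
    by (intro that[of "Min ?S"]) (force simp: consecutive_def btw_def)+
next
  case False
  let ?S = "{w \<in> V. w < p}"
  have S: "finite ?S" "z \<in> ?S" using assms False by auto
  have "Max ?S \<in> ?S" using S by (intro Max_in) auto
  moreover have le: "w \<le> Max ?S" if "w \<in> ?S" for w using S(1) that by (rule Max_ge)
  moreover note le[OF S(2)]
  ultimately show thesis
    by (intro that[of "Max ?S"]) (force simp: consecutive_def btw_def)+
qed

section \<open>Arcs and modules of the inverted tournament\<close>

abbreviation inv_tournament :: "'a::linorder set \<Rightarrow> 'a set set \<Rightarrow> ('a, 'a \<times> 'a) pre_digraph" where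
  "inv_tournament V Q \<equiv> with_proj (Inv (transitive_tournament V) Q)"

lemma arcs_ends_inv_tournament:
  "(x, y) \<in> arcs_ends (inv_tournament V Q) \<longleftrightarrow>
    x \<in> V \<and> y \<in> V \<and> x \<noteq> y \<and> (x < y \<longleftrightarrow> \<not> edge Q x y)"
proof -
  have "(x, y) \<in> arcs_ends (inv_tournament V Q) \<longleftrightarrow>
      x \<in> V \<and> y \<in> V \<and> (x < y \<and> \<not> edge Q x y \<or> y < x \<and> edge Q y x)"
    by (auto simp: Inv_def transitive_tournament_def edge_def)
  also have "\<dots> \<longleftrightarrow> x \<in> V \<and> y \<in> V \<and> x \<noteq> y \<and> (x < y \<longleftrightarrow> \<not> edge Q x y)"
    unfolding edge_commute[of Q y x] by auto
  finally show ?thesis .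
qed

lemma verts_inv_tournament: "verts (inv_tournament V Q) = V"
  by (simp add: Inv_def transitive_tournament_def)

text \<open>\<open>Q\<close> can be kept whole, since pairs containing \<open>p\<close> reverse no
  arc of the smaller tournament.\<close>

lemma del_vert_inv_tournament:
  "pre_digraph.del_vert (inv_tournament V Q) p = inv_tournament (V - {p}) Q"
  by (auto simp: pre_digraph.del_vert_def Inv_def transitive_tournament_def with_proj_def)

text \<open>\<open>z\<close> dominates \<open>x\<close> iff \<open>z < x\<close> and
  \<open>edge Q z x\<close> have different truth values. Passing from \<open>x\<close> to
  \<open>y\<close>, the first value flips iff \<open>z\<close> lies between them; in a module both
  values flip or neither does.\<close>

lemma module_inv_tournament_iff:
  "module (inv_tournament V Q) M \<longleftrightarrow>
    M \<subseteq> V \<and> (\<forall>z\<in>V - M. \<forall>x\<in>M. \<forall>y\<in>M. btw x z y \<longleftrightarrow> (edge Q z x \<longleftrightarrow> \<not> edge Q z y))"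
  (is "?L \<longleftrightarrow> ?R")
proof -
  have "({z} \<times> M \<subseteq> arcs_ends (inv_tournament V Q) \<or> M \<times> {z} \<subseteq> arcs_ends (inv_tournament V Q))
      \<longleftrightarrow> (\<forall>x\<in>M. \<forall>y\<in>M. btw x z y \<longleftrightarrow> (edge Q z x \<longleftrightarrow> \<not> edge Q z y))"
    if "M \<subseteq> V" "z \<in> V - M" for z
  proof -
    have out: "(z, x) \<in> arcs_ends (inv_tournament V Q) \<longleftrightarrow> (z < x \<longleftrightarrow> \<not> edge Q z x)" if "x \<in> M" for x
      unfolding arcs_ends_inv_tournament using that \<open>M \<subseteq> V\<close> \<open>z \<in> V - M\<close> by blast
    have in': "(x, z) \<in> arcs_ends (inv_tournament V Q) \<longleftrightarrow> \<not> (z < x \<longleftrightarrow> \<not> edge Q z x)" if "x \<in> M" for x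
      unfolding arcs_ends_inv_tournament edge_commute[of Q x z]
      using that \<open>M \<subseteq> V\<close> \<open>z \<in> V - M\<close> by (metis Diff_iff linorder_neqE order_less_asym subsetD)
    have "btw x z y \<longleftrightarrow> (z < x \<longleftrightarrow> \<not> z < y)" if "x \<in> M" "y \<in> M" for x y
      using that \<open>z \<in> V - M\<close> by (metis Diff_iff btw_def linorder_neqE order_less_asym)
    then have "(\<forall>x\<in>M. \<forall>y\<in>M. btw x z y \<longleftrightarrow> (edge Q z x \<longleftrightarrow> \<not> edge Q z y)) \<longleftrightarrow>
      (\<forall>x\<in>M. z < x \<longleftrightarrow> \<not> edge Q z x) \<or> (\<forall>x\<in>M. \<not> (z < x \<longleftrightarrow> \<not> edge Q z x))"
      by blast
    moreover have "{z} \<times> M \<subseteq> arcs_ends (inv_tournament V Q) \<longleftrightarrow> (\<forall>x\<in>M. z < x \<longleftrightarrow> \<not> edge Q z x)"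
      using out by blast
    moreover have "M \<times> {z} \<subseteq> arcs_ends (inv_tournament V Q) \<longleftrightarrow> (\<forall>x\<in>M. \<not> (z < x \<longleftrightarrow> \<not> edge Q z x))"
      using in' by blast
    ultimately show ?thesis by simp
  qed
  then show ?thesis
    unfolding module_def verts_inv_tournament by blast
qed

section \<open>Near-matchings and the deletion of a leaf\<close>

text \<open>
  For \<open>a = b\<close> this is a perfect matching, which is how the tournaments on \<open>V - {a}\<close>
  and \<open>V - {b}\<close> are covered by the same argument.
\<close>

locale near_matching =
  fixes V :: "'a::linorder set" and Q :: "'a set set" and h a b :: 'a
  assumes finite_V: "finite V"
    and irrefl: "\<not> edge Q x x"
    and neighbour: "x \<in> V \<Longrightarrow> \<exists>y\<in>V. edge Q x y"
    and unique: "\<lbrakk>x \<in> V; y \<in> V; z \<in> V; edge Q x y; edge Q x z; x \<noteq> h\<rbrakk> \<Longrightarrow> y = z"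
    and hub_neighbour: "\<lbrakk>y \<in> V; edge Q h y\<rbrakk> \<Longrightarrow> y = a \<or> y = b"
    and in_V: "h \<in> V" "a \<in> V" "b \<in> V"
    and hub: "edge Q h a" "edge Q h b"
begin

lemma swap: "near_matching V Q h b a"
  by unfold_locales (use finite_V irrefl neighbour unique hub_neighbour in_V hub in blast)+

lemma hub_distinct: "h \<noteq> a" "h \<noteq> b"
  using hub irrefl by metis+

lemma leaf: "x \<in> V \<Longrightarrow> edge Q x a \<Longrightarrow> x = h" "x \<in> V \<Longrightarrow> edge Q x b \<Longrightarrow> x = h"
  using unique hub hub_distinct in_V edge_commute by metis+

lemma closed_interval_not_singleton:
  assumes "closed_interval V Q I"
  shows "I \<noteq> {v}"
proof
  assume "I = {v}"
  then have "v \<in> V" using closed_intervalD(1)[OF assms] by blast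
  then obtain w where w: "w \<in> V" "edge Q v w" using neighbour by blast
  then have "w = v" using closed_intervalD(5)[OF assms, of v w] \<open>I = {v}\<close> by blast
  then show False using w(2) irrefl by blast
qed

lemma not_indecomposable:
  assumes "closed_interval V Q I"
  shows "\<not> indecomposable (inv_tournament V Q)"
proof -
  note I = closed_intervalD[OF assms]
  have "module (inv_tournament V Q) I"
    unfolding module_inv_tournament_iff
  proof (intro conjI ballI)
    fix z x y assume z: "z \<in> V - I" and xy: "x \<in> I" "y \<in> I"
    have "\<not> edge Q z r" if "r \<in> I" for r
      using I(5)[OF that, of z] z edge_commute[of Q z r] by blast
    then show "btw x z y \<longleftrightarrow> (edge Q z x \<longleftrightarrow> \<not> edge Q z y)"
      using I(4)[OF xy, of z] z xy by blast
  qed (fact I(1))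
  moreover have "\<not> trivial_module (inv_tournament V Q) I"
    unfolding trivial_module_def verts_inv_tournament
    using I(2,3) closed_interval_not_singleton[OF assms] by blast
  ultimately show ?thesis unfolding indecomposable_def by blast
qed

lemma delete_leaf:
  assumes "a \<noteq> b"
  shows "near_matching (V - {a}) Q h b b"
proof unfold_locales
  show "\<exists>y\<in>V - {a}. edge Q x y" if "x \<in> V - {a}" for x
    using that neighbour leaf(1) hub in_V assms by (metis Diff_iff singletonD)
  show "y = b \<or> y = b" if "y \<in> V - {a}" "edge Q h y" for y
    using that hub_neighbour by blast
qed (use finite_V irrefl unique in_V hub hub_distinct assms in auto)

text \<open>\<open>h\<close> and \<open>a\<close> are both in \<open>I\<close> or both outside, so
  \<open>h\<close> witnesses that \<open>I - {a}\<close> is nonempty in the first case and proper in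
  the second.\<close>

lemma closed_interval_delete_leaf:
  assumes "a \<noteq> b" "closed_interval V Q I"
  shows "closed_interval (V - {a}) Q (I - {a})"
proof -
  note I = closed_intervalD[OF assms(2)]
  have "h \<in> I \<longleftrightarrow> a \<in> I"
    using I(5) hub in_V edge_commute by metis
  then show ?thesis
    using I hub_distinct in_V by (intro closed_intervalI) blast+
qed

text \<open>\<open>I\<close>, enlarged by \<open>a\<close> if \<open>h \<in> I\<close>, is proper
  and closed under \<open>Q\<close> in \<open>V\<close>, so it can only fail to be an interval.
  Either some \<open>u\<close> separates \<open>a\<close> from an element of \<open>I\<close>, or
  \<open>a\<close> lies between two elements of \<open>I\<close>.\<close>

lemma closed_interval_delete_leafE:
  assumes "a \<noteq> b" "closed_interval (V - {a}) Q I" "\<nexists>J. closed_interval V Q J"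
  obtains u e where "h \<in> I" "b \<in> I" "u \<in> V - I" "u \<noteq> a" "e \<in> I" "btw a u e"
    | i j where "h \<notin> I" "b \<notin> I" "i \<in> I" "j \<in> I" "btw i a j"
proof -
  note I = closed_intervalD[OF assms(2)]
  have hb: "h \<in> I \<longleftrightarrow> b \<in> I"
    using I(5) hub in_V edge_commute hub_distinct assms(1) by (metis Diff_iff singletonD)
  show thesis
  proof (cases "h \<in> I")
    case True
    have "\<not> closed_interval V Q (insert a I)" using assms(3) by blast
    moreover have "insert a I \<subseteq> V" "insert a I \<noteq> {}" "insert a I \<noteq> V"
      using I(1,3) in_V by blast+
    moreover have "y \<in> insert a I" if "x \<in> insert a I" "y \<in> V" "edge Q x y" for x y
      using that I(5) True leaf(1) edge_commute by (metis Diff_iff insertE insertI2 singletonD insertI1)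
    ultimately obtain x y z where "x \<in> insert a I" "y \<in> insert a I" "z \<in> V" "btw x z y" "z \<notin> insert a I"
      using closed_intervalI[of "insert a I" V Q] by blast
    moreover from this have "x = a \<and> y \<in> I \<or> x \<in> I \<and> y = a"
      using I(4)[of x y z] by (auto simp: btw_def)
    ultimately obtain e where "e \<in> I" "btw a z e" "z \<in> V - I" "z \<noteq> a"
      using btw_commute[of x z y] by blast
    then show thesis using that(1)[of z e] True hb by blast
  next
    case False
    have "\<not> closed_interval V Q I" using assms(3) by blast
    moreover have "I \<subseteq> V" "I \<noteq> {}" "I \<noteq> V"
      using I(1,2) in_V by blast+
    moreover have "y \<in> I" if "x \<in> I" "y \<in> V" "edge Q x y" for x y
      using that I(1,5) False leaf(1) by blast
    ultimately obtain x y z where "x \<in> I" "y \<in> I" "z \<in> V" "btw x z y" "z \<notin> I"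
      using closed_intervalI[of I V Q] by blast
    with I(4) have "z = a" by blast
    then show thesis using that(2) False hb \<open>x \<in> I\<close> \<open>y \<in> I\<close> \<open>btw x z y\<close> by blast
  qed
qed

text \<open>Consecutive elements lie on the same side of every other element, so \<open>x\<close>
  could replace \<open>a\<close> in the betweenness given by
  \<open>closed_interval_delete_leafE\<close>, and \<open>I\<close> would not be an interval of
  \<open>V - {a}\<close>.\<close>

lemma not_consecutive_leaf:
  assumes "a \<noteq> b" "closed_interval (V - {a}) Q I" "\<nexists>J. closed_interval V Q J"
    and x: "x = h \<or> x = b"
  shows "\<not> consecutive V a x"
proof
  assume c: "consecutive V a x"
  note I = closed_intervalD[OF assms(2)]
  have xa: "x \<noteq> a" "x \<in> V" using x assms(1) hub_distinct in_V by auto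
  from assms(1-3) show False
  proof (cases rule: closed_interval_delete_leafE)
    case (1 u e)
    then have "x \<in> I" using x by blast
    have "\<not> btw a u x" using c 1 by (auto simp: consecutive_def)
    moreover have "e \<in> V" "\<not> btw a e x" using c I(1) 1 by (auto simp: consecutive_def)
    moreover have "x \<noteq> u" using \<open>x \<in> I\<close> 1 by blast
    ultimately have "btw x u e"
      using \<open>btw a u e\<close> \<open>x \<in> I\<close> 1 xa by (auto simp: btw_def)
    then show False using I(4)[OF \<open>x \<in> I\<close> \<open>e \<in> I\<close>] 1 by blast
  next
    case (2 i j)
    then have "x \<notin> I" using x by blast
    have "\<not> btw a i x" "\<not> btw a j x" using c I(1) 2 by (auto simp: consecutive_def)
    moreover have "i \<noteq> x" "j \<noteq> x" using 2 \<open>x \<notin> I\<close> by blast+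
    ultimately have "btw i x j" using 2 xa by (auto simp: btw_def)
    then show False using I(4) 2 \<open>x \<notin> I\<close> xa by blast
  qed
qed

text \<open>Up to reversal the order is \<open>a, z, h, c\<close>. If \<open>h, b \<in> I\<close>,
  then \<open>b\<close> lies beyond \<open>c\<close>, so \<open>c\<close> and its partner
  \<open>z\<close> are in \<open>I\<close>, and \<open>u\<close> separates \<open>z\<close> from
  \<open>e\<close> as it separates \<open>a\<close> from \<open>e\<close>. If
  \<open>h, b \<notin> I\<close>, then \<open>z\<close> and \<open>c\<close> are in
  \<open>I\<close>, which forces \<open>h\<close> into \<open>I\<close>.\<close>

lemma special_configuration_impossible:
  assumes "a \<noteq> b" "closed_interval (V - {a}) Q I" "\<nexists>J. closed_interval V Q J"
    and "z \<in> V" "c \<in> V" "edge Q z c" "btw a z h" "btw z h c" "consecutive V a z"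
    and "b \<noteq> c" "\<not> btw a b c"
  shows False
proof -
  note I = closed_intervalD[OF assms(2)]
  have za: "z \<noteq> a" "c \<noteq> a" using assms(7,8) by (auto simp: btw_def)
  have zc: "z \<in> I \<longleftrightarrow> c \<in> I" using I(5) assms(4-6) za edge_commute by (metis Diff_iff singletonD)
  from assms(1-3) show False
  proof (cases rule: closed_interval_delete_leafE)
    case (1 u e)
    \<comment> \<open>Otherwise \<open>u\<close> would fall between \<open>e\<close> and one of
      \<open>h\<close>, \<open>b\<close>, all of which are in \<open>I\<close>.\<close>
    have "\<not> btw h a b"
    proof
      assume "btw h a b"
      then have "btw h u e \<or> btw b u e" using btw_split 1(6) by blast
      then show False using I(4) 1 by blast
    qed
    then have "btw h c b" using assms by (auto simp: btw_def)
    then have "c \<in> I" using I(4) 1 assms(5) za by blast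
    then have "z \<in> I" using zc by blast
    have "\<not> btw a u z" using assms(9) 1 by (auto simp: consecutive_def)
    moreover have "\<not> btw a e z" using assms(9) I(1) 1 by (auto simp: consecutive_def)
    moreover have "z \<noteq> u" using \<open>z \<in> I\<close> 1 by blast
    ultimately have "btw z u e"
      using \<open>btw a u e\<close> \<open>z \<in> I\<close> 1 za by (auto simp: btw_def)
    then show False using I(4)[OF \<open>z \<in> I\<close> \<open>e \<in> I\<close>] 1 by blast
  next
    case (2 i j)
    have "\<not> btw a i z" "\<not> btw a j z" using assms(9) I(1) 2 by (auto simp: consecutive_def)
    then have "z = i \<or> z = j \<or> btw i z j" using 2 za by (auto simp: btw_def)
    then have "z \<in> I" using I(4) 2 assms(4) za by blast
    then have "h \<in> I" using zc I(4) assms(8) in_V hub_distinct by blast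
    then show False using 2 by blast
  qed
qed

end

section \<open>Classification of modules when no edge is short\<close>

text \<open>Applied both to perfect matchings (\<open>a = b\<close>) and to \<open>Q\<close> itself.
  The guard in \<open>spread_leaves\<close> is there because \<open>consecutive V a a\<close> always
  holds.\<close>

locale spread_near_matching = near_matching +
  assumes spread_edge: "\<lbrakk>x \<in> V; y \<in> V; edge Q x y\<rbrakk> \<Longrightarrow> \<not> consecutive V x y"
    and spread_leaves: "a \<noteq> b \<Longrightarrow> \<not> consecutive V a b"
    and irreducible: "\<not> closed_interval V Q J"
begin

text \<open>The only neighbour of either leaf is \<open>h\<close>, which is matched to both. Hence
  no vertex is matched to exactly one leaf, and a vertex between them must be in
  \<open>M\<close>.\<close>

lemma leaves_separated:
  assumes M: "module (inv_tournament V Q) M" and "a \<in> M" "b \<in> M" "a \<noteq> b"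
  shows "\<exists>u\<in>M. btw a u b"
proof -
  obtain u where u: "u \<in> V" "btw a u b"
    using spread_leaves assms(4) unfolding consecutive_def by blast
  have "u \<in> M"
  proof (rule ccontr)
    assume "u \<notin> M"
    then have "edge Q u a \<longleftrightarrow> \<not> edge Q u b"
      using M u assms(2,3) unfolding module_inv_tournament_iff by blast
    then show False using leaf u(1) hub by metis
  qed
  with u show ?thesis by blast
qed

lemma two_neighbours:
  assumes "z \<in> V" "x \<in> V" "y \<in> V" "x \<noteq> y" "edge Q z x" "edge Q z y"
  shows "z = h" "{x, y} = {a, b}" "a \<noteq> b"
proof -
  show "z = h" using assms unique by blast
  then have "x = a \<or> x = b" "y = a \<or> y = b" using assms hub_neighbour by blast+
  with assms(4) show "{x, y} = {a, b}" "a \<noteq> b" by auto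
qed

text \<open>In both cases of the proof some vertex outside \<open>M\<close> turns out to be the hub,
  with both leaves in \<open>M\<close>. By \<open>leaves_separated\<close> some
  \<open>u \<in> M\<close> lies between the leaves, and \<open>u\<close> is then forced to be a leaf
  itself.\<close>

lemma interval_if_large_module:
  assumes M: "module (inv_tournament V Q) M" and "card M \<ge> 3"
    and "x \<in> M" "y \<in> M" "z \<in> V" "btw x z y"
  shows "z \<in> M"
proof (rule ccontr)
  assume "z \<notin> M"
  have mod: "btw x z y \<longleftrightarrow> (edge Q z x \<longleftrightarrow> \<not> edge Q z y)" if "z \<in> V - M" "x \<in> M" "y \<in> M" for x y z
    using M that unfolding module_inv_tournament_iff by blast
  have MV: "M \<subseteq> V" using M unfolding module_inv_tournament_iff by blast
  have "\<exists>p m. p \<in> M \<and> m \<in> M \<and> edge Q z p \<and> \<not> edge Q z m \<and> btw p z m"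
    using mod[of z x y] assms(3-6) \<open>z \<notin> M\<close> btw_commute by (metis DiffI)
  then obtain p m where p: "p \<in> M" "m \<in> M" "edge Q z p" "\<not> edge Q z m" "btw p z m" by blast
  show False
  proof (cases "\<exists>r\<in>M. r \<noteq> p \<and> edge Q z r")
    case True
    then obtain r where r: "r \<in> M" "r \<noteq> p" "edge Q z r" by blast
    note two = two_neighbours[OF assms(5) _ _ _ r(3) p(3)]
    have "z = h" "{r, p} = {a, b}" "a \<noteq> b" using two r p MV by blast+
    then obtain u where u: "u \<in> M" "btw r u p"
      using leaves_separated[OF M] r p btw_commute by (metis doubleton_eq_iff)
    \<comment> \<open>\<open>z\<close> is matched to both \<open>r\<close> and \<open>p\<close>, so
      it is not between them, nor between \<open>p\<close> and the inner point
      \<open>u\<close>.\<close>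
    have "\<not> btw r z p" using mod r p \<open>z \<notin> M\<close> assms(5) by blast
    then have "\<not> btw u z p" using u by (auto simp: btw_def)
    then have "edge Q z u" using mod u p \<open>z \<notin> M\<close> assms(5) by blast
    then have "u = a \<or> u = b" using \<open>z = h\<close> hub_neighbour u MV by blast
    then show False using u \<open>{r, p} = {a, b}\<close> by (auto simp: btw_def doubleton_eq_iff)
  next
    case False
    have pz: "p \<noteq> z" using p \<open>z \<notin> M\<close> by blast
    \<comment> \<open>Here \<open>z\<close> separates \<open>p\<close> from the rest of
      \<open>M\<close>, and so does the element \<open>w\<close> next to \<open>p\<close> on that
      side. As \<open>w\<close> is not matched to \<open>p\<close>, it is matched to all the
      rest.\<close>
    then obtain w where w: "w \<in> V" "w \<noteq> p" "consecutive V p w" "w = z \<or> btw p w z"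
      using exists_consecutive finite_V assms(5) by metis
    have other: "btw p z r" if "r \<in> M" "r \<noteq> p" for r
      using mod that p False \<open>z \<notin> M\<close> assms(5) by blast
    have pw: "\<not> edge Q w p" using spread_edge[of p w] w p MV edge_commute[of Q w p] by blast
    have wM: "w \<notin> M" using w(2,4) other[of w] \<open>z \<notin> M\<close> by (auto simp: btw_def)
    have wr: "edge Q w r" if "r \<in> M" "r \<noteq> p" for r
    proof -
      have "btw p w r" using other[OF that] w(4) by (auto simp: btw_def)
      then show ?thesis using mod[of w p r] that p w wM pw by blast
    qed
    have "card (M - {p}) \<ge> 2" using assms(2) p by (simp add: card_Diff_singleton)
    moreover have "finite (M - {p})" using MV finite_V finite_subset by blast
    ultimately have "\<not> (\<forall>r\<in>M - {p}. \<forall>s\<in>M - {p}. r = s)"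
      using card_le_Suc0_iff_eq[of "M - {p}"] by simp
    then obtain r s where rs: "r \<in> M" "s \<in> M" "r \<noteq> p" "s \<noteq> p" "r \<noteq> s" by blast
    have ab: "w = h" "{r, s} = {a, b}" "a \<noteq> b"
      using two_neighbours[of w r s] wr rs w MV by blast+
    then obtain u where u: "u \<in> M" "btw r u s"
      using leaves_separated[OF M] rs btw_commute by (metis doubleton_eq_iff)
    have "u \<noteq> p" using u(2) other[of r] other[of s] rs by (auto simp: btw_def)
    then have "u = a \<or> u = b" using wr u ab hub_neighbour MV by blast
    then show False using u ab by (auto simp: btw_def doubleton_eq_iff)
  qed
qed

text \<open>An outside neighbour of an element of \<open>M\<close> lies between no two elements of
  \<open>M\<close>, hence is matched to all of \<open>M\<close>; but no vertex has three
  neighbours.\<close>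

lemma large_module_trivial:
  assumes M: "module (inv_tournament V Q) M" and "card M \<ge> 3"
  shows "M = V"
proof (rule ccontr)
  assume "M \<noteq> V"
  have MV: "M \<subseteq> V" using M unfolding module_inv_tournament_iff by blast
  have "closed_interval V Q M"
  proof (rule closed_intervalI)
    show "M \<noteq> {}" using assms(2) by auto
    show "y \<in> M" if "x \<in> M" "y \<in> V" "edge Q x y" for x y
    proof (rule ccontr)
      assume "y \<notin> M"
      have all: "edge Q y r" if "r \<in> M" for r
        using M interval_if_large_module[OF assms \<open>x \<in> M\<close> that \<open>y \<in> V\<close>] \<open>y \<notin> M\<close> \<open>x \<in> M\<close> \<open>y \<in> V\<close>
          \<open>edge Q x y\<close> that edge_commute[of Q x y]
        unfolding module_inv_tournament_iff by blast
      have "M \<subseteq> {a, b}"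
      proof (cases "y = h")
        case True
        then show ?thesis using all hub_neighbour MV by blast
      next
        case False
        then have "M \<subseteq> {x}" using all unique[of y _ x] MV \<open>x \<in> M\<close> \<open>y \<in> V\<close> by blast
        then show ?thesis using assms(2) card_mono[of "{x}" M] by simp
      qed
      then have "card M \<le> card {a, b}" by (intro card_mono) auto
      also have "\<dots> \<le> 2" by (simp add: card_insert_if)
      finally show False using assms(2) by simp
    qed
  qed (fact MV \<open>M \<noteq> V\<close> interval_if_large_module[OF assms])+
  then show False using irreducible by blast
qed

text \<open>The elements produced here satisfy \<open>{x, y} = {p, c}\<close>.\<close>

lemma two_element_module:
  assumes M: "module (inv_tournament V Q) {x, y}" and "x \<noteq> y" and V6: "card V \<ge> 6"
  obtains p p' c z where "{p, p'} = {a, b}" "p \<noteq> p'" "z \<in> V" "c \<in> V" "edge Q z c" "btw p z h"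
    "btw z h c" "consecutive V p z" "p' \<noteq> c" "\<not> btw p p' c"
proof -
  have xy: "x \<in> V" "y \<in> V" using M unfolding module_inv_tournament_iff by simp_all
  have mod: "btw x z y \<longleftrightarrow> (edge Q z x \<longleftrightarrow> \<not> edge Q z y)" if "z \<in> V" "z \<noteq> x" "z \<noteq> y" for z
    using M that unfolding module_inv_tournament_iff by simp
  have nab: "\<not> ({x, y} = {a, b})"
    using leaves_separated[of "{x, y}"] M assms(2) by (auto simp: btw_def doubleton_eq_iff)
  define H where "H = {x, y} \<union> {z \<in> V. btw x z y}"
  have HV: "H \<subseteq> V" "x \<in> H" "y \<in> H" using xy by (auto simp: H_def)
  have conv: "v \<in> H" if "r \<in> H" "s \<in> H" "v \<in> V" "btw r v s" for r s v
    using that by (auto simp: H_def btw_def)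
  \<comment> \<open>Such a \<open>v\<close> is matched to both or to neither of \<open>x\<close>,
    \<open>y\<close>; both would make them the two leaves, against \<open>nab\<close>.\<close>
  have out: "\<not> edge Q v x \<and> \<not> edge Q v y" if "v \<in> V" "v \<notin> H" for v
    using that mod[of v] two_neighbours[of v x y] xy assms(2) nab by (auto simp: H_def)
  define N where "N r = {v \<in> V. edge Q r v}" for r
  have N1: "card (N r) \<le> 1" if "r \<in> V" "r \<noteq> h" for r
    using unique that by (auto simp: N_def card_le_Suc0_iff_eq finite_V)
  have N2: "card (N h) \<le> 2"
  proof -
    have "N h \<subseteq> {a, b}" using hub_neighbour by (auto simp: N_def)
    then have "card (N h) \<le> card {a, b}" by (intro card_mono) auto
    also have "\<dots> \<le> 2" by (simp add: card_insert_if)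
    finally show ?thesis .
  qed
  have "H \<subseteq> {x, y} \<union> (N x \<union> N y)"
  proof
    fix v assume "v \<in> H"
    then show "v \<in> {x, y} \<union> (N x \<union> N y)"
      using mod[of v] edge_commute[of Q v x] edge_commute[of Q v y] by (auto simp: H_def N_def)
  qed
  then have "card H \<le> card ({x, y} \<union> (N x \<union> N y))"
    using finite_V by (intro card_mono) (auto simp: N_def)
  also have "\<dots> \<le> card {x, y} + (card (N x) + card (N y))"
    by (meson add_left_mono card_Un_le order_trans)
  \<comment> \<open>\<open>x\<close> and \<open>y\<close> themselves and at most three neighbours,
    as only one of them can be the hub.\<close>
  also have "\<dots> \<le> 5"
    using N1[of x] N1[of y] N2 xy assms(2) by (cases "x = h"; cases "y = h") auto
  finally have "H \<noteq> V" using V6 by auto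
  \<comment> \<open>Some edge leaves the proper interval \<open>H\<close>. Its inner end
    \<open>r\<close> lies strictly between \<open>x\<close> and \<open>y\<close>, so it is also
    matched to one of them; two neighbours make \<open>r\<close> the hub.\<close>
  then have "\<not> (\<forall>r\<in>H. \<forall>s\<in>V. edge Q r s \<longrightarrow> s \<in> H)"
    using irreducible closed_intervalI[of H V Q] conv HV by blast
  then obtain r s where rs: "r \<in> H" "s \<in> V" "edge Q r s" "s \<notin> H" by blast
  have rM: "r \<noteq> x" "r \<noteq> y" using out[OF rs(2,4)] rs(3) edge_commute[of Q r s] by blast+
  then have r: "r \<in> V" "btw x r y" using rs by (auto simp: H_def)
  have "\<exists>p c. {x, y} = {p, c} \<and> edge Q r p"
    using mod[of r] r rM by (metis insert_commute)
  then obtain p c where p: "{x, y} = {p, c}" "edge Q r p" by blast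
  have pc: "p \<in> H" "c \<in> H" "p \<noteq> c" using p HV assms(2) by (auto simp: doubleton_eq_iff)
  have ps: "r = h" "{p, s} = {a, b}"
    using two_neighbours[of r p s] p rs r HV pc by blast+
  have "p \<noteq> s" using pc rs by blast
  have btw_pc: "btw x v y \<longleftrightarrow> btw p v c" for v
    using p(1) by (auto simp: btw_def doubleton_eq_iff)
  have Hpc: "H = {p, c} \<union> {z \<in> V. btw p z c}"
    using p(1) by (simp add: H_def btw_pc)
  have h: "btw p h c" using r ps btw_pc by blast
  obtain z where z: "z \<in> V" "edge Q c z" using neighbour[of c] pc HV by blast
  have zc: "edge Q z c" using z edge_commute[of Q z c] by blast
  have pleaf: "v = h" if "v \<in> V" "edge Q v p" for v
    using leaf that ps by (metis doubleton_eq_iff)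
  \<comment> \<open>Everything strictly between \<open>p\<close> and \<open>c\<close> is matched to
    one of them. As \<open>p\<close> and \<open>h\<close> are not consecutive, this will force the
    partner \<open>z\<close> of \<open>c\<close> between them.\<close>
  have inner: "v = h \<or> v = z" if "v \<in> V" "btw p v c" for v
  proof -
    have "v \<noteq> x" "v \<noteq> y" "btw x v y"
      using that(2) btw_pc[of v] by (auto simp: btw_def)
    then have "edge Q v p \<or> edge Q v c" using mod that p(1) by (metis doubleton_eq_iff)
    then show ?thesis
      using pleaf[OF that(1)] unique[of c v z] z edge_commute[of Q v c] that pc HV h
      by (auto simp: btw_def)
  qed
  have "\<not> consecutive V p h" using spread_edge[of p h] in_V ps p(2) pc HV edge_commute[of Q p h] by blast
  then obtain v where v: "v \<in> V" "btw p v h" unfolding consecutive_def by blast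
  moreover have "btw p v c" using v h by (auto simp: btw_def)
  ultimately have pzh: "btw p z h" using inner by (auto simp: btw_def)
  show thesis
  proof (rule that[of p s z c])
    show "btw z h c" using pzh h by (auto simp: btw_def)
    show "consecutive V p z" unfolding consecutive_def
    proof (intro ballI notI)
      fix v assume v: "v \<in> V" "btw p v z"
      then have "btw p v c" using pzh h by (auto simp: btw_def)
      then show False using inner[OF v(1)] v pzh by (auto simp: btw_def)
    qed
    show "s \<noteq> c" "\<not> btw p s c" using rs Hpc by auto
  qed (use ps \<open>p \<noteq> s\<close> z zc pzh pc HV in auto)
qed

lemma decomposable_configuration:
  assumes V6: "card V \<ge> 6" and "\<not> indecomposable (inv_tournament V Q)"
  obtains p p' c z where "{p, p'} = {a, b}" "p \<noteq> p'" "z \<in> V" "c \<in> V" "edge Q z c" "btw p z h"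
    "btw z h c" "consecutive V p z" "p' \<noteq> c" "\<not> btw p p' c"
proof -
  obtain M where M: "module (inv_tournament V Q) M" "\<not> trivial_module (inv_tournament V Q) M"
    using assms(2) unfolding indecomposable_def by blast
  have nt: "M \<noteq> {}" "M \<noteq> V" "\<And>v. v \<in> V \<Longrightarrow> M \<noteq> {v}"
    using M(2) unfolding trivial_module_def verts_inv_tournament by blast+
  have MV: "M \<subseteq> V" using M(1) unfolding module_inv_tournament_iff by blast
  then have "finite M" using finite_V finite_subset by blast
  then have "card M \<noteq> 0" using nt(1) by simp
  moreover have "card M \<noteq> 1" using nt(3) MV by (metis card_1_singletonE insert_subset)
  moreover have "\<not> card M \<ge> 3" using large_module_trivial M(1) nt(2) by blast
  ultimately have "card M = 2" by linarith
  then obtain x y where xy: "M = {x, y}" "x \<noteq> y" by (meson card_2_iff)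
  show thesis by (rule two_element_module[OF M(1)[unfolded xy(1)] xy(2) V6]) (rule that)
qed

end

section \<open>Closed intervals versus indecomposability\<close>

context near_matching
begin

text \<open>An edge joining consecutive elements would be a closed interval, so without closed
  intervals the matching is spread. The remaining configuration needs two distinct leaves.\<close>

lemma matching_closed_interval:
  assumes "a = b" "card V \<ge> 6" "\<not> indecomposable (inv_tournament V Q)"
  shows "\<exists>I. closed_interval V Q I"
proof (rule ccontr)
  assume irr: "\<nexists>I. closed_interval V Q I"
  interpret spread_near_matching V Q h a b
  proof unfold_locales
    fix x y assume xy: "x \<in> V" "y \<in> V" "edge Q x y"
    show "\<not> consecutive V x y"
    proof
      assume c: "consecutive V x y"
      have "card {x, y} \<le> 2" by (simp add: card_insert_if)
      then have "{x, y} \<noteq> V" using assms(2) by auto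
      have u: "v = w" if "r \<in> V" "v \<in> V" "w \<in> V" "edge Q r v" "edge Q r w" for r v w
        using that unique hub_neighbour assms(1) by metis
      have "closed_interval V Q {x, y}"
      proof (rule closed_intervalI)
        show "s \<in> {x, y}" if "r \<in> {x, y}" "s \<in> V" "edge Q r s" for r s
          using that u[of x s y] u[of y s x] xy edge_commute[of Q x y] by blast
      qed (use xy c \<open>{x, y} \<noteq> V\<close> in \<open>auto simp: consecutive_def btw_def\<close>)
      then show False using irr by blast
    qed
  qed (use assms(1) irr in blast)+
  show False
    using decomposable_configuration[OF assms(2,3)] assms(1) by (metis doubleton_eq_iff)
qed

text \<open>If all three tournaments are decomposable and \<open>V\<close> has no closed interval,
  the two perfect matchings have closed intervals \<open>I\<close> and \<open>J\<close>. These
  restrict the positions of \<open>a\<close> and \<open>b\<close>: they make \<open>Q\<close> spread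
  and then refute the configuration from \<open>decomposable_configuration\<close>.\<close>

lemma no_closed_interval_iff:
  assumes "a \<noteq> b" and V7: "card V \<ge> 7"
  shows "(\<nexists>I. closed_interval V Q I) \<longleftrightarrow> indecomposable (inv_tournament V Q) \<or>
    indecomposable (inv_tournament (V - {a}) Q) \<or> indecomposable (inv_tournament (V - {b}) Q)"
proof
  note ba = assms(1)[symmetric]
  show "\<nexists>I. closed_interval V Q I" if "indecomposable (inv_tournament V Q) \<or>
    indecomposable (inv_tournament (V - {a}) Q) \<or> indecomposable (inv_tournament (V - {b}) Q)"
  proof
    assume "\<exists>I. closed_interval V Q I"
    then obtain I where I: "closed_interval V Q I" by blast
    note not_indecomposable[OF I]
      near_matching.not_indecomposable[OF delete_leaf[OF assms(1)]
        closed_interval_delete_leaf[OF assms(1) I]]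
      near_matching.not_indecomposable[OF near_matching.delete_leaf[OF swap ba]
        near_matching.closed_interval_delete_leaf[OF swap ba I]]
    with that show False by blast
  qed
next
  note ba = assms(1)[symmetric]
  assume irr: "\<nexists>I. closed_interval V Q I"
  show "indecomposable (inv_tournament V Q) \<or>
    indecomposable (inv_tournament (V - {a}) Q) \<or> indecomposable (inv_tournament (V - {b}) Q)"
  proof (rule ccontr)
    assume dec: "\<not> ?thesis"
    have "card (V - {a}) \<ge> 6" "card (V - {b}) \<ge> 6"
      using V7 in_V by (simp_all add: card_Diff_singleton)
    then obtain I J where I: "closed_interval (V - {a}) Q I" and J: "closed_interval (V - {b}) Q J"
      using dec near_matching.matching_closed_interval[OF delete_leaf[OF assms(1)] refl]
        near_matching.matching_closed_interval[OF near_matching.delete_leaf[OF swap ba] refl] by meson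
    note nca = not_consecutive_leaf[OF assms(1) I irr]
      and ncb = near_matching.not_consecutive_leaf[OF swap ba J irr]
    interpret spread_near_matching V Q h a b
    proof unfold_locales
      fix x y assume xy: "x \<in> V" "y \<in> V" "edge Q x y"
      show "\<not> consecutive V x y"
      proof
        assume c: "consecutive V x y"
        \<comment> \<open>An edge at the hub ends in a leaf, which \<open>nca\<close> and
          \<open>ncb\<close> keep from being consecutive to \<open>h\<close>.\<close>
        have no_hub: "r \<noteq> h" if "{x, y} = {r, s}" "s \<in> V" "edge Q r s" for r s
        proof
          assume "r = h"
          then have "s = a \<or> s = b" using hub_neighbour that by blast
          moreover have "consecutive V s r"
            using c that(1) consecutive_commute[of V x y] by (auto simp: doubleton_eq_iff)
          ultimately show False using nca ncb \<open>r = h\<close> by blast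
        qed
        have "x \<noteq> h" "y \<noteq> h"
          using no_hub[of x y] no_hub[of y x] xy edge_commute[of Q x y] by (simp_all add: insert_commute)
        have "card {x, y} \<le> 2" by (simp add: card_insert_if)
        then have "{x, y} \<noteq> V" using V7 by auto
        have "closed_interval V Q {x, y}"
        proof (rule closed_intervalI)
          show "s \<in> {x, y}" if "r \<in> {x, y}" "s \<in> V" "edge Q r s" for r s
            using that unique[of x s y] unique[of y s x] xy edge_commute[of Q x y]
              \<open>x \<noteq> h\<close> \<open>y \<noteq> h\<close> by blast
        qed (use xy c \<open>{x, y} \<noteq> V\<close> in \<open>auto simp: consecutive_def btw_def\<close>)
        then show False using irr by blast
      qed
    qed (use nca irr in blast)+
    have "card V \<ge> 6" using V7 by simp
    moreover have "\<not> indecomposable (inv_tournament V Q)" using dec by blast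
    ultimately obtain p p' c z where pp: "{p, p'} = {a, b}" "p \<noteq> p'"
      and conf: "z \<in> V" "c \<in> V" "edge Q z c" "btw p z h" "btw z h c" "consecutive V p z"
        "p' \<noteq> c" "\<not> btw p p' c"
      by (rule decomposable_configuration)
    have "p = a \<and> p' = b \<or> p = b \<and> p' = a" using pp by (auto simp: doubleton_eq_iff)
    then show False
      using special_configuration_impossible[OF assms(1) I irr] conf
        near_matching.special_configuration_impossible[OF swap ba J irr] by blast
  qed
qed

end

section \<open>From quasi-pairings to near-matchings\<close>

lemma quasi_pairing_near_matching:
  fixes V :: "'a::linorder set"
  assumes "quasi_pairing V Q"
  shows "near_matching V Q (v_hat Q) (v_minus Q) (v_plus Q)"
proof -
  note N = v_minus_v_plus[OF assms]
  have Q: "\<And>e. e \<in> Q \<Longrightarrow> e \<subseteq> V \<and> card e = 2" "\<Union>Q = V" and fin: "finite V"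
    using assms unfolding quasi_pairing_def by (auto intro: card_ge_0_finite)
  have hN: "{v_hat Q, y} \<in> Q \<longleftrightarrow> y = v_minus Q \<or> y = v_plus Q" for y
    using N(1) by blast
  show ?thesis
  proof
    show "finite V" by (rule fin)
    show "\<not> edge Q x x" for x using Q(1)[of "{x}"] by (auto simp: edge_def)
    show "v_hat Q \<in> V" "v_minus Q \<in> V" "v_plus Q \<in> V"
      using hN Q(1) by blast+
    show "edge Q (v_hat Q) (v_minus Q)" "edge Q (v_hat Q) (v_plus Q)"
      using hN by (auto simp: edge_def)
    show "y = v_minus Q \<or> y = v_plus Q" if "edge Q (v_hat Q) y" for y
      using that hN by (auto simp: edge_def)
  next
    fix x assume "x \<in> V"
    then obtain e where e: "e \<in> Q" "x \<in> e" using Q(2) by blast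
    then obtain u v where "e = {u, v}" using Q(1) by (meson card_2_iff)
    then show "\<exists>y\<in>V. edge Q x y"
      using e Q(1)[OF e(1)] unfolding edge_def by (auto simp: insert_commute)
  next
    fix x y z assume *: "x \<in> V" "edge Q x y" "edge Q x z" "x \<noteq> v_hat Q"
    then have "card {e \<in> Q. x \<in> e} = 1" using v_hat_degree(3)[OF assms] by blast
    then obtain e where "{e \<in> Q. x \<in> e} = {e}" by (rule card_1_singletonE)
    moreover have "{x, y} \<in> {e \<in> Q. x \<in> e}" "{x, z} \<in> {e \<in> Q. x \<in> e}"
      using * by (simp_all add: edge_def)
    ultimately have "{x, y} = e" "{x, z} = e" by simp_all
    then show "y = z" by (auto simp: doubleton_eq_iff)
  qed
qed

text \<open>The blocks of \<open>Q_part Q\<close> are the connected components of the graph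
  \<open>Q\<close>: single edges and the star at \<open>v_hat Q\<close>. Unions of blocks are
  therefore the subsets of \<open>V\<close> closed under \<open>edge Q\<close>.\<close>

lemma irreducible_quasi_pairing_iff:
  fixes V :: "'a::linorder set"
  assumes "quasi_pairing V Q"
  shows "irreducible_quasi_pairing V Q \<longleftrightarrow> (\<nexists>I. closed_interval V Q I)"
proof -
  interpret near_matching V Q "v_hat Q" "v_minus Q" "v_plus Q"
    by (rule quasi_pairing_near_matching[OF assms])
  have part: "partition_on V (Q_part Q)" by (rule partition_on_Q_part[OF assms])
  have Q2: "e \<subseteq> V \<and> card e = 2" if "e \<in> Q" for e
    using assms that unfolding quasi_pairing_def by blast
  have block: "\<exists>C\<in>Q_part Q. e \<subseteq> C" if "e \<in> Q" for e
    using that by (auto simp: Q_part_def B_block_def)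
  have edge_block: "y \<in> C" if C: "C \<in> Q_part Q" "x \<in> C" "edge Q x y" for x y C
  proof -
    obtain D where "D \<in> Q_part Q" "x \<in> D" "y \<in> D"
      using block C(3) unfolding edge_def by blast
    moreover have "disjoint (Q_part Q)" using part by (rule partition_onD2)
    ultimately show ?thesis using C disjointD by blast
  qed
  have block_subset: "C \<subseteq> I" if I: "closed_interval V Q I" and "x \<in> I" "x \<in> C" "C \<in> Q_part Q"
    for x C I
  proof -
    note I = closed_intervalD[OF I]
    show ?thesis
    proof (cases "C \<in> Q")
      case True
      then obtain u v where uv: "C = {u, v}" using Q2 by (meson card_2_iff)
      then have "edge Q u v" "edge Q v u" "u \<in> V" "v \<in> V"
        using True Q2[OF True] by (auto simp: edge_def insert_commute)
      then show ?thesis using I(5)[of u v] I(5)[of v u] that uv by blast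
    next
      case False
      then have "C = {v_hat Q, v_minus Q, v_plus Q}" using that by (auto simp: Q_part_def B_block_def)
      \<comment> \<open>Closure leads from any element of the star to its centre, and from there to
        both leaves.\<close>
      then have "v_hat Q \<in> I"
        using that I(5)[of _ "v_hat Q"] hub in_V edge_commute[of Q "v_hat Q"] by blast
      then show ?thesis using \<open>C = _\<close> I(5) hub in_V by blast
    qed
  qed
  have "nontrivial_interval_of V I \<and> (\<exists>\<B>\<subseteq>Q_part Q. I = \<Union>\<B>) \<longleftrightarrow> closed_interval V Q I" for I
  proof (intro iffI conjI)
    assume I: "nontrivial_interval_of V I \<and> (\<exists>\<B>\<subseteq>Q_part Q. I = \<Union>\<B>)"
    then have "y \<in> I" if "x \<in> I" "edge Q x y" for x y
      using that edge_block by blast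
    then show "closed_interval V Q I"
      using I unfolding nontrivial_interval_of_def closed_interval_def by blast
  next
    assume I: "closed_interval V Q I"
    have "I = \<Union>{C \<in> Q_part Q. C \<subseteq> I}"
    proof (intro equalityI subsetI)
      fix x assume x: "x \<in> I"
      then have "x \<in> \<Union>(Q_part Q)"
        using closed_intervalD(1)[OF I] partition_onD1[OF part] by blast
      then show "x \<in> \<Union>{C \<in> Q_part Q. C \<subseteq> I}" using block_subset[OF I x] by blast
    qed blast
    moreover have "{C \<in> Q_part Q. C \<subseteq> I} \<subseteq> Q_part Q" by blast
    ultimately show "\<exists>\<B>\<subseteq>Q_part Q. I = \<Union>\<B>" by (intro exI conjI)
    have "\<not> is_singleton I"
      using closed_interval_not_singleton[OF I] by (auto elim: is_singletonE)
    then show "nontrivial_interval_of V I"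
      using I unfolding nontrivial_interval_of_def closed_interval_def by blast
  qed
  then show ?thesis
    using part assms unfolding irreducible_quasi_pairing_def irreducible_partition_def by simp
qed

theorem corollary3p2:
  fixes V :: "'a::linorder set" and Q :: "'a set set"
  assumes "finite V" and "odd (card V)" and "card V \<ge> 7"
    and "quasi_pairing V Q"
  defines "T \<equiv> with_proj (Inv (transitive_tournament V) Q)"
  shows "irreducible_quasi_pairing V Q \<longleftrightarrow>
    indecomposable T \<or>
    indecomposable (pre_digraph.del_vert T (v_minus Q)) \<or>
    indecomposable (pre_digraph.del_vert T (v_plus Q))"
  unfolding T_def del_vert_inv_tournament irreducible_quasi_pairing_iff[OF assms(4)]
  using v_minus_v_plus(2)[OF assms(4)] assms(3)
  by (intro near_matching.no_closed_interval_iff[OF quasi_pairing_near_matching[OF assms(4)]]) auto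

end
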